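(* For every topological space $X$, the Hausdorff reflection $\mu_X:X\to X_H$ is a shape equivalence, i.e. the shape morphism induced by $\mu_X$ is an isomorphism in the shape category.
   Context: Hausdorff reflection: for a topological space $X$, let $R_3$ be the equivalence relation $x\,R_3\,y$ iff $f(x)=f(y)$ for every continuous map $f:X\to Z$ with $Z$ Hausdorff. Then $X_H=X/R_3$ with the quotient topology, and $\mu_X:X\to X_H$ is the quotient map; $X_H$ is Hausdorff and every continuous map from $X$ to a Hausdorff space factors continuously through $\mu_X$. Shape: the shape category of topological spaces is that of Mardešić–Segal. A continuous map $f:X\to Y$ is a shape equivalence (the shape morphism it induces is an isomorphism) if and only if for every metric ANR $P$ (equivalently, every polyhedron or CW-complex $P$) the function $[Y,P]\to[X,P]$, $[h]\mapsto[h\circ f]$, on homotopy classes of continuous maps is a bijection. *)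

theory Defs
  imports "HOL-Analysis.Analysis"
begin

section \<open>Hausdorff reflection\<close>

text \<open>
  The test spaces \<open>Z\<close> live on the type of points of \<open>X\<close>. This loses nothing: the image of a map from
  \<open>X\<close> to a Hausdorff space of any type is in bijection with a set of representatives in \<open>X\<close>; see
  \<open>R3_imp_eq\<close>, where the type of \<open>Z\<close> is arbitrary.
\<close>

definition R3 :: "'a topology \<Rightarrow> ('a \<times> 'a) set" where
  "R3 X = {(x, y). x \<in> topspace X \<and> y \<in> topspace X \<and>
     (\<forall>(Z :: 'a topology) f. Hausdorff_space Z \<longrightarrow> continuous_map X Z f \<longrightarrow> f x = f y)}"

definition quotient_space :: "'a topology \<Rightarrow> ('a \<times> 'a) set \<Rightarrow> 'a set topology" where
  "quotient_space X R = topology (\<lambda>U. U \<subseteq> topspace X // R \<and> openin X {x \<in> topspace X. R `` {x} \<in> U})"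

definition hausdorff_reflection :: "'a topology \<Rightarrow> 'a set topology" where
  "hausdorff_reflection X = quotient_space X (R3 X)"

definition hausdorff_proj :: "'a topology \<Rightarrow> 'a \<Rightarrow> 'a set" where
  "hausdorff_proj X x = R3 X `` {x}"

lemma openin_quotient_space:
  "openin (quotient_space X R) U \<longleftrightarrow>
     U \<subseteq> topspace X // R \<and> openin X {x \<in> topspace X. R `` {x} \<in> U}"
proof -
  have "istopology (\<lambda>U. U \<subseteq> topspace X // R \<and> openin X {x \<in> topspace X. R `` {x} \<in> U})"
    unfolding istopology_def
  proof (intro conjI allI impI)
    fix S T
    assume S: "S \<subseteq> topspace X // R \<and> openin X {x \<in> topspace X. R `` {x} \<in> S}"
      and T: "T \<subseteq> topspace X // R \<and> openin X {x \<in> topspace X. R `` {x} \<in> T}"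
    show "S \<inter> T \<subseteq> topspace X // R" using S by blast
    have "{x \<in> topspace X. R `` {x} \<in> S \<inter> T} =
            {x \<in> topspace X. R `` {x} \<in> S} \<inter> {x \<in> topspace X. R `` {x} \<in> T}" by blast
    then show "openin X {x \<in> topspace X. R `` {x} \<in> S \<inter> T}" using S T by auto
  next
    fix K
    assume K: "\<forall>S\<in>K. S \<subseteq> topspace X // R \<and> openin X {x \<in> topspace X. R `` {x} \<in> S}"
    show "\<Union>K \<subseteq> topspace X // R" using K by blast
    have "{x \<in> topspace X. R `` {x} \<in> \<Union>K} = (\<Union>S\<in>K. {x \<in> topspace X. R `` {x} \<in> S})" by blast
    then show "openin X {x \<in> topspace X. R `` {x} \<in> \<Union>K}" using K by auto
  qed
  then show ?thesis by (simp add: quotient_space_def)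
qed

lemma topspace_quotient_space: "topspace (quotient_space X R) = topspace X // R"
proof
  show "topspace (quotient_space X R) \<subseteq> topspace X // R"
    using openin_quotient_space openin_topspace by blast
  have "{x \<in> topspace X. R `` {x} \<in> topspace X // R} = topspace X"
    by (auto simp: quotient_def)
  then have "openin (quotient_space X R) (topspace X // R)"
    by (simp add: openin_quotient_space)
  then show "topspace X // R \<subseteq> topspace (quotient_space X R)"
    by (rule openin_subset)
qed

lemma quotient_map_hausdorff_proj:
  "quotient_map X (hausdorff_reflection X) (hausdorff_proj X)"
  unfolding quotient_map_def hausdorff_reflection_def hausdorff_proj_def
  by (auto simp: openin_quotient_space topspace_quotient_space quotient_def)

lemma equiv_R3: "equiv (topspace X) (R3 X)"
  unfolding equiv_def refl_on_def sym_def trans_def R3_def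
  by (auto; metis)

lemma R3_imp_eq:
  fixes Z :: "'z topology"
  assumes "(x, y) \<in> R3 X" and Z: "Hausdorff_space Z" and f: "continuous_map X Z f"
  shows "f x = f y"
proof -
  let ?S = "f ` topspace X"
  define s where "s = inv_into (topspace X) f"
  have fs: "f (s z) = z" if "z \<in> ?S" for z
    using that by (simp add: s_def f_inv_into_f)
  define Z' where "Z' = pullback_topology (s ` ?S) f Z"
  have top: "topspace Z' = s ` ?S"
    using continuous_map_image_subset_topspace [OF f] fs
    by (auto simp: Z'_def topspace_pullback_topology)
  have cf: "continuous_map Z' Z f"
    unfolding Z'_def using continuous_map_pullback [OF continuous_map_id] by simp
  have inj: "inj_on f (topspace Z')"
    unfolding top using fs by (auto simp: inj_on_def)
  have "Hausdorff_space Z'"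
    using Hausdorff_space_injective_preimage [OF Z cf inj] .
  moreover have "continuous_map X Z' (s \<circ> f)"
    unfolding Z'_def
  proof (rule continuous_map_pullback')
    show "continuous_map X Z (f \<circ> (s \<circ> f))"
      by (rule continuous_map_eq [OF f]) (simp add: fs)
    show "topspace X \<subseteq> (s \<circ> f) -` s ` ?S" by auto
  qed
  ultimately have "(s \<circ> f) x = (s \<circ> f) y"
    using assms(1) unfolding R3_def by blast
  moreover have "x \<in> topspace X" "y \<in> topspace X" using assms(1) by (auto simp: R3_def)
  ultimately show ?thesis by (metis comp_apply fs imageI)
qed

section \<open>Homotopy classes and ANRs\<close>

abbreviation homotopic :: "'a topology \<Rightarrow> 'b topology \<Rightarrow> ('a \<Rightarrow> 'b) \<Rightarrow> ('a \<Rightarrow> 'b) \<Rightarrow> bool" where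
  "homotopic X Y f g \<equiv> homotopic_with (\<lambda>_. True) X Y f g"

definition homotopy_rel :: "'a topology \<Rightarrow> 'b topology \<Rightarrow> (('a \<Rightarrow> 'b) \<times> ('a \<Rightarrow> 'b)) set" where
  "homotopy_rel X Y = {(f, g). homotopic X Y f g}"

definition homotopy_classes :: "'a topology \<Rightarrow> 'b topology \<Rightarrow> ('a \<Rightarrow> 'b) set set" where
  "homotopy_classes X Y = {f. continuous_map X Y f} // homotopy_rel X Y"

text \<open>The map \<open>[h] \<mapsto> [h \<circ> f]\<close> on homotopy classes of maps into \<open>P\<close>; \<open>X\<close> is the domain of \<open>f\<close>.\<close>

definition homotopy_precomp ::
    "'a topology \<Rightarrow> 'p topology \<Rightarrow> ('a \<Rightarrow> 'b) \<Rightarrow> ('b \<Rightarrow> 'p) set \<Rightarrow> ('a \<Rightarrow> 'p) set" where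
  "homotopy_precomp X P f c = (\<Union>h\<in>c. homotopy_rel X P `` {h \<circ> f})"

text \<open>
  Absolute neighbourhood retracts for metrizable spaces: \<open>P\<close> is a retract of a neighbourhood in every
  metrizable space containing it as a closed subspace. It suffices to let the ambient space range over
  spaces on the type \<open>'p \<Rightarrow> real\<close>: the Kuratowski--Wojdyslawski theorem embeds \<open>P\<close> as a closed subset of
  a convex set of bounded real functions on \<open>P\<close>, and a neighbourhood retract of such a convex set is an
  ANR by Dugundji's extension theorem.
\<close>

definition metric_ANR :: "'p topology \<Rightarrow> bool" where
  "metric_ANR P \<longleftrightarrow> metrizable_space P \<and>
     (\<forall>(Z :: ('p \<Rightarrow> real) topology) e.
        metrizable_space Z \<and> embedding_map P Z e \<and> closedin Z (e ` topspace P) \<longrightarrow>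
        (\<exists>U. openin Z U \<and> e ` topspace P \<subseteq> U \<and> (e ` topspace P) retract_of_space (subtopology Z U)))"

text \<open>
  Objects of \<open>HPol\<close>: the spaces with the homotopy type of a polyhedron, equivalently of a metric ANR.
\<close>

definition HPol_space :: "'p topology \<Rightarrow> bool" where
  "HPol_space P \<longleftrightarrow> (\<exists>Q :: 'p topology. metric_ANR Q \<and> P homotopy_equivalent_space Q)"

section \<open>The pro-category of HPol\<close>

text \<open>
  Morphisms of the homotopy category are represented by continuous maps; equality of morphisms is
  \<^const>\<open>homotopic\<close>. The bonding map \<open>bond S i j\<close> goes from the \<open>j\<close>-th to the \<open>i\<close>-th term.
\<close>

record ('i, 'p) inv_system =
  idx :: "'i set"
  le :: "'i \<Rightarrow> 'i \<Rightarrow> bool"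
  term_of :: "'i \<Rightarrow> 'p topology"
  bond :: "'i \<Rightarrow> 'i \<Rightarrow> 'p \<Rightarrow> 'p"

definition directed_index :: "'i set \<Rightarrow> ('i \<Rightarrow> 'i \<Rightarrow> bool) \<Rightarrow> bool" where
  "directed_index I r \<longleftrightarrow> I \<noteq> {} \<and> (\<forall>i\<in>I. r i i) \<and>
     (\<forall>i\<in>I. \<forall>j\<in>I. \<forall>k\<in>I. r i j \<longrightarrow> r j k \<longrightarrow> r i k) \<and>
     (\<forall>i\<in>I. \<forall>j\<in>I. \<exists>k\<in>I. r i k \<and> r j k)"

definition pro_HPol_object :: "('i, 'p) inv_system \<Rightarrow> bool" where
  "pro_HPol_object S \<longleftrightarrow> directed_index (idx S) (le S) \<and>
     (\<forall>i\<in>idx S. HPol_space (term_of S i) \<and> homotopic (term_of S i) (term_of S i) (bond S i i) id) \<and>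
     (\<forall>i\<in>idx S. \<forall>j\<in>idx S. le S i j \<longrightarrow> continuous_map (term_of S j) (term_of S i) (bond S i j)) \<and>
     (\<forall>i\<in>idx S. \<forall>j\<in>idx S. \<forall>k\<in>idx S. le S i j \<longrightarrow> le S j k \<longrightarrow>
        homotopic (term_of S k) (term_of S i) (bond S i j \<circ> bond S j k) (bond S i k))"

text \<open>
  A morphism of systems \<open>S \<rightarrow> T\<close> is an index function \<open>ind\<close> from the indices of \<open>T\<close> to those of \<open>S\<close>
  together with maps \<open>comp_at j\<close> from the \<open>ind j\<close>-th term of \<open>S\<close> to the \<open>j\<close>-th term of \<open>T\<close>.
  Morphisms of the pro-category are morphisms of systems modulo \<open>pro_eq\<close>.
\<close>

record ('i, 'p) sys_map =
  ind :: "'i \<Rightarrow> 'i"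
  comp_at :: "'i \<Rightarrow> 'p \<Rightarrow> 'p"

definition pro_morphism :: "('i, 'p) inv_system \<Rightarrow> ('i, 'p) inv_system \<Rightarrow> ('i, 'p) sys_map \<Rightarrow> bool" where
  "pro_morphism S T f \<longleftrightarrow>
     (\<forall>j\<in>idx T. ind f j \<in> idx S \<and>
        continuous_map (term_of S (ind f j)) (term_of T j) (comp_at f j)) \<and>
     (\<forall>j\<in>idx T. \<forall>k\<in>idx T. le T j k \<longrightarrow>
        (\<exists>i\<in>idx S. le S (ind f j) i \<and> le S (ind f k) i \<and>
           homotopic (term_of S i) (term_of T j)
             (comp_at f j \<circ> bond S (ind f j) i)
             (bond T j k \<circ> comp_at f k \<circ> bond S (ind f k) i)))"

definition pro_eq ::
    "('i, 'p) inv_system \<Rightarrow> ('i, 'p) inv_system \<Rightarrow> ('i, 'p) sys_map \<Rightarrow> ('i, 'p) sys_map \<Rightarrow> bool" where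
  "pro_eq S T f g \<longleftrightarrow>
     (\<forall>j\<in>idx T. \<exists>i\<in>idx S. le S (ind f j) i \<and> le S (ind g j) i \<and>
        homotopic (term_of S i) (term_of T j)
          (comp_at f j \<circ> bond S (ind f j) i) (comp_at g j \<circ> bond S (ind g j) i))"

definition pro_id :: "('i, 'p) sys_map" where
  "pro_id = \<lparr>ind = id, comp_at = (\<lambda>_. id)\<rparr>"

definition pro_comp :: "('i, 'p) sys_map \<Rightarrow> ('i, 'p) sys_map \<Rightarrow> ('i, 'p) sys_map" where
  "pro_comp g f = \<lparr>ind = ind f \<circ> ind g, comp_at = (\<lambda>k. comp_at g k \<circ> comp_at f (ind g k))\<rparr>"

definition pro_iso :: "('i, 'p) inv_system \<Rightarrow> ('i, 'p) inv_system \<Rightarrow> ('i, 'p) sys_map \<Rightarrow> bool" where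
  "pro_iso S T f \<longleftrightarrow> pro_morphism S T f \<and>
     (\<exists>g. pro_morphism T S g \<and> pro_eq S S (pro_comp g f) pro_id \<and> pro_eq T T (pro_comp f g) pro_id)"

section \<open>Expansions and shape\<close>

text \<open>Morphisms from a space, regarded as a rudimentary system, to a system.\<close>

definition cone :: "'a topology \<Rightarrow> ('i, 'p) inv_system \<Rightarrow> ('i \<Rightarrow> 'a \<Rightarrow> 'p) \<Rightarrow> bool" where
  "cone X S p \<longleftrightarrow> (\<forall>i\<in>idx S. continuous_map X (term_of S i) (p i)) \<and>
     (\<forall>i\<in>idx S. \<forall>j\<in>idx S. le S i j \<longrightarrow> homotopic X (term_of S i) (p i) (bond S i j \<circ> p j))"

definition cone_eq ::
    "'a topology \<Rightarrow> ('i, 'p) inv_system \<Rightarrow> ('i \<Rightarrow> 'a \<Rightarrow> 'p) \<Rightarrow> ('i \<Rightarrow> 'a \<Rightarrow> 'p) \<Rightarrow> bool" where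
  "cone_eq X S p q \<longleftrightarrow> (\<forall>i\<in>idx S. homotopic X (term_of S i) (p i) (q i))"

definition cone_comp :: "('i, 'p) sys_map \<Rightarrow> ('i \<Rightarrow> 'a \<Rightarrow> 'p) \<Rightarrow> 'i \<Rightarrow> 'a \<Rightarrow> 'p" where
  "cone_comp f p = (\<lambda>j. comp_at f j \<circ> p (ind f j))"

text \<open>
  \<open>HPol\<close>-expansions, by their universal property. The index type of \<open>T\<close> may be fixed: applied to systems
  with a single index, the property already gives the conditions that every map from \<open>X\<close> to an
  \<open>HPol\<close>-space factors up to homotopy through some term of \<open>S\<close>, and that two such factorizations agree
  further along \<open>S\<close>; these imply the property for systems over any index type.
\<close>

definition HPol_expansion :: "'a topology \<Rightarrow> ('i, 'p) inv_system \<Rightarrow> ('i \<Rightarrow> 'a \<Rightarrow> 'p) \<Rightarrow> bool" where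
  "HPol_expansion X S p \<longleftrightarrow> pro_HPol_object S \<and> cone X S p \<and>
     (\<forall>(T :: ('i, 'p) inv_system) h. pro_HPol_object T \<and> cone X T h \<longrightarrow>
        (\<exists>f. pro_morphism S T f \<and> cone_eq X T (cone_comp f p) h \<and>
           (\<forall>g. pro_morphism S T g \<and> cone_eq X T (cone_comp g p) h \<longrightarrow> pro_eq S T f g)))"

text \<open>
  A shape morphism \<open>X \<rightarrow> Y\<close> is given, for expansions \<open>p : X \<rightarrow> S\<close> and \<open>q : Y \<rightarrow> T\<close>, by a morphism \<open>S \<rightarrow> T\<close>
  of the pro-category (for other expansions, by conjugating with the canonical isomorphisms). The one
  induced by a map \<open>m : X \<rightarrow> Y\<close> is given by the unique \<open>f\<close> with \<open>f \<circ> p = q \<circ> m\<close>, and it is an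
  isomorphism iff \<open>f\<close> is one.

  The types \<open>'i\<close> of indices and \<open>'p\<close> of points of polyhedra are universe bounds: for each \<open>X\<close> and \<open>Y\<close>,
  all types that are large enough admit expansions, and a result about shape equivalences is to be
  stated for arbitrary \<open>'i\<close> and \<open>'p\<close>.
\<close>

definition induces_pro_morphism ::
    "'a topology \<Rightarrow> ('i \<Rightarrow> 'a \<Rightarrow> 'p) \<Rightarrow> ('i, 'p) inv_system \<Rightarrow>
     ('i \<Rightarrow> 'b \<Rightarrow> 'p) \<Rightarrow> ('i, 'p) inv_system \<Rightarrow> ('a \<Rightarrow> 'b) \<Rightarrow> ('i, 'p) sys_map \<Rightarrow> bool" where
  "induces_pro_morphism X p S q T m f \<longleftrightarrow>
     pro_morphism S T f \<and> cone_eq X T (cone_comp f p) (\<lambda>j. q j \<circ> m)"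

definition shape_equivalence ::
    "'i itself \<Rightarrow> 'p itself \<Rightarrow> 'a topology \<Rightarrow> 'b topology \<Rightarrow> ('a \<Rightarrow> 'b) \<Rightarrow> bool" where
  "shape_equivalence _ _ X Y m \<longleftrightarrow> continuous_map X Y m \<and>
     (\<forall>(S :: ('i, 'p) inv_system) p (T :: ('i, 'p) inv_system) q.
        HPol_expansion X S p \<and> HPol_expansion Y T q \<longrightarrow>
        (\<exists>f. induces_pro_morphism X p S q T m f \<and> pro_iso S T f))"

end

theory Submission
  imports Defs
begin

text \<open>
  Why the theorem holds. A map from \<open>X\<close> to a Hausdorff space \<open>Z\<close> is constant on the classes of
  \<^const>\<open>R3\<close>, so it descends to \<open>X\<^sub>H\<close>. The same is true of homotopies: since \<open>[0,1]\<close> is locally compact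
  Hausdorff, \<open>id \<times> \<mu>\<close> is again a quotient map from \<open>[0,1] \<times> X\<close> onto \<open>[0,1] \<times> X\<^sub>H\<close>, and a homotopy
  \<open>[0,1] \<times> X \<rightarrow> Z\<close> is constant on its fibres because each stage of it is a map \<open>X \<rightarrow> Z\<close>. Hence
  \<open>[X\<^sub>H, Z] \<rightarrow> [X, Z]\<close> is surjective (\<open>factors_through_hausdorff_proj\<close>) and injective
  (\<open>homotopic_hausdorff_proj_cancel\<close>), in particular for metric ANRs \<open>Z\<close>, which are metrizable.

  Spaces that are only homotopy equivalent to a metric ANR need not be Hausdorff, but bijectivity
  is invariant under homotopy equivalence of the target, so it holds for all objects of \<open>HPol\<close>.

  The passage to shape, \<open>shape_equivalence_if_bij_on_HPol\<close>, is formal. Let \<open>m : X \<rightarrow> Y\<close> induce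
  bijections \<open>[Y, P] \<rightarrow> [X, P]\<close> for all \<open>P\<close> in \<open>HPol\<close>, and let \<open>p : X \<rightarrow> S\<close> and \<open>q : Y \<rightarrow> T\<close> be
  expansions. Then cones over \<open>X\<close> and cones over \<open>Y\<close> correspond to each other, so \<open>p\<close> is, up to
  homotopy, \<open>p' \<circ> m\<close> for a cone \<open>p'\<close> over \<open>Y\<close>. The universal property of \<open>p\<close> applied to \<open>q \<circ> m\<close> gives
  the induced morphism \<open>f : S \<rightarrow> T\<close>, that of \<open>q\<close> applied to \<open>p'\<close> gives \<open>g : T \<rightarrow> S\<close>, and the uniqueness
  parts force \<open>f\<close> and \<open>g\<close> to be inverse to each other.
\<close>

section \<open>Maps from the Hausdorff reflection up to homotopy\<close>

lemma homotopic_postcomp: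
  "homotopic X Y f g \<Longrightarrow> continuous_map Y Z h \<Longrightarrow> homotopic X Z (h \<circ> f) (h \<circ> g)"
  by (rule homotopic_with_compose_continuous_map_left) auto

lemma homotopic_precomp:
  "homotopic Y Z f g \<Longrightarrow> continuous_map X Y h \<Longrightarrow> homotopic X Z (f \<circ> h) (g \<circ> h)"
  by (rule homotopic_with_compose_continuous_map_right) auto

lemma continuous_map_hausdorff_proj:
  "continuous_map X (hausdorff_reflection X) (hausdorff_proj X)"
  by (rule quotient_imp_continuous_map [OF quotient_map_hausdorff_proj])

lemma hausdorff_proj_eq_imp_eq:
  assumes "Hausdorff_space Z" "continuous_map X Z f" "x \<in> topspace X" "y \<in> topspace X"
    and "hausdorff_proj X x = hausdorff_proj X y"
  shows "f x = f y"
proof (rule R3_imp_eq [OF _ assms(1,2)])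
  show "(x, y) \<in> R3 X"
    using assms(5,4) unfolding hausdorff_proj_def by (rule eq_equiv_class [OF _ equiv_R3])
qed

lemma factors_through_hausdorff_proj:
  assumes "Hausdorff_space Z" "continuous_map X Z f"
  obtains g where "continuous_map (hausdorff_reflection X) Z g"
    "\<And>x. x \<in> topspace X \<Longrightarrow> g (hausdorff_proj X x) = f x"
  using quotient_map_lift_exists [OF quotient_map_hausdorff_proj assms(2)]
    hausdorff_proj_eq_imp_eq [OF assms] by metis

text \<open>
  The homotopy on \<open>X\<close> descends along the quotient map \<open>id \<times> \<mu>\<close>; this is where local compactness of
  \<open>[0,1]\<close> enters.
\<close>

lemma homotopic_hausdorff_proj_cancel:
  fixes X :: "'a topology"
  assumes Z: "Hausdorff_space Z"
    and h: "continuous_map (hausdorff_reflection X) Z h"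
    and k: "continuous_map (hausdorff_reflection X) Z k"
    and hk: "homotopic X Z (h \<circ> hausdorff_proj X) (k \<circ> hausdorff_proj X)"
  shows "homotopic (hausdorff_reflection X) Z h k"
proof -
  let ?I = "top_of_set {0..1::real}" and ?m = "hausdorff_proj X" and ?Y = "hausdorff_reflection X"
  obtain H where H: "continuous_map (prod_topology ?I X) Z H"
      "\<And>x. H (0, x) = h (?m x)" "\<And>x. H (1, x) = k (?m x)"
    using hk unfolding homotopic_with_def by auto
  have "Hausdorff_space ?I"
    by (simp add: Hausdorff_space_subtopology)
  moreover have "locally_compact_space ?I"
    by (rule compact_imp_locally_compact_space) (simp add: compact_space_subtopology)
  ultimately have quot: "quotient_map (prod_topology ?I X) (prod_topology ?I ?Y) (\<lambda>(t, x). (t, ?m x))"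
    by (intro quotient_map_prod_right quotient_map_hausdorff_proj) auto
  have fibres: "H a = H b"
    if "a \<in> topspace (prod_topology ?I X)" "b \<in> topspace (prod_topology ?I X)"
      "(\<lambda>(t, x). (t, ?m x)) a = (\<lambda>(t, x). (t, ?m x)) b" for a b
  proof -
    obtain t x s y where "a = (t, x)" "b = (s, y)"
      by (meson surj_pair)
    with that have ab: "a = (t, x)" "b = (t, y)" "t \<in> topspace ?I"
        "x \<in> topspace X" "y \<in> topspace X" "?m x = ?m y"
      by auto
    have "(H \<circ> Pair t) x = (H \<circ> Pair t) y"
      by (rule hausdorff_proj_eq_imp_eq [OF Z continuous_map_o_Pair [OF H(1) ab(3)] ab(4-6)])
    then show ?thesis by (simp add: ab)
  qed
  obtain G where G: "continuous_map (prod_topology ?I ?Y) Z G"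
      "\<And>a. a \<in> topspace (prod_topology ?I X) \<Longrightarrow> G ((\<lambda>(t, x). (t, ?m x)) a) = H a"
    by (rule quotient_map_lift_exists [OF quot H(1)]) (erule (2) fibres, rule that)
  have ends: "G (0, ?m x) = h (?m x)" "G (1, ?m x) = k (?m x)" if "x \<in> topspace X" for x
    using G(2) [of "(0, x)"] G(2) [of "(1, x)"] H(2,3) that by auto
  have surj: "?m ` topspace X = topspace ?Y"
    by (rule quotient_imp_surjective_map [OF quotient_map_hausdorff_proj])
  show ?thesis
  proof (subst homotopic_with, simp, intro exI conjI ballI)
    show "continuous_map (prod_topology ?I ?Y) Z G" by (rule G(1))
    show "G (0, y) = h y" if "y \<in> topspace ?Y" for y
      using that ends(1) unfolding surj [symmetric] by blast
    show "G (1, y) = k y" if "y \<in> topspace ?Y" for y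
      using that ends(2) unfolding surj [symmetric] by blast
  qed auto
qed

lemma metric_ANR_imp_Hausdorff_space: "metric_ANR P \<Longrightarrow> Hausdorff_space P"
  by (simp add: metric_ANR_def metrizable_imp_Hausdorff_space)

lemma HPol_space_homotopy_equivalence:
  fixes P :: "'p topology"
  assumes "HPol_space P"
  obtains Q :: "'p topology" and \<phi> \<psi> where "Hausdorff_space Q" "continuous_map P Q \<phi>" "continuous_map Q P \<psi>"
    "homotopic P P (\<psi> \<circ> \<phi>) id"
proof -
  obtain Q :: "'p topology" where "metric_ANR Q" "P homotopy_equivalent_space Q"
    using assms unfolding HPol_space_def by blast
  with that show thesis
    unfolding homotopy_equivalent_space_def by (metis metric_ANR_imp_Hausdorff_space)
qed

text \<open>
  An object of \<open>HPol\<close> is a homotopy retract of a Hausdorff space \<open>Q\<close>. Maps and homotopies are moved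
  to \<open>Q\<close>, pushed down to \<open>X\<^sub>H\<close> there, and brought back; the factorization therefore holds only up to
  homotopy.
\<close>

lemma HPol_factors_through_hausdorff_proj:
  fixes P :: "'p topology"
  assumes P: "HPol_space P" and u: "continuous_map X P u"
  shows "\<exists>h. continuous_map (hausdorff_reflection X) P h \<and> homotopic X P (h \<circ> hausdorff_proj X) u"
proof -
  obtain Q :: "'p topology" and \<phi> \<psi> where Q: "Hausdorff_space Q" and \<phi>: "continuous_map P Q \<phi>"
      and \<psi>: "continuous_map Q P \<psi>" and hom: "homotopic P P (\<psi> \<circ> \<phi>) id"
    by (rule HPol_space_homotopy_equivalence [OF P])
  obtain g where g: "continuous_map (hausdorff_reflection X) Q g"
      "\<And>x. x \<in> topspace X \<Longrightarrow> g (hausdorff_proj X x) = (\<phi> \<circ> u) x"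
    by (rule factors_through_hausdorff_proj [OF Q continuous_map_compose [OF u \<phi>]]) (rule that)
  have "homotopic X P ((\<psi> \<circ> g) \<circ> hausdorff_proj X) u"
    by (rule homotopic_with_eq [OF homotopic_precomp [OF hom u]]) (simp_all add: g(2))
  then show ?thesis
    using continuous_map_compose [OF g(1) \<psi>] by blast
qed

lemma HPol_homotopic_hausdorff_proj_cancel:
  fixes P :: "'p topology"
  assumes P: "HPol_space P"
    and h: "continuous_map (hausdorff_reflection X) P h"
    and k: "continuous_map (hausdorff_reflection X) P k"
    and hk: "homotopic X P (h \<circ> hausdorff_proj X) (k \<circ> hausdorff_proj X)"
  shows "homotopic (hausdorff_reflection X) P h k"
proof -
  let ?Y = "hausdorff_reflection X"
  obtain Q :: "'p topology" and \<phi> \<psi> where Q: "Hausdorff_space Q" and \<phi>: "continuous_map P Q \<phi>"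
      and \<psi>: "continuous_map Q P \<psi>" and hom: "homotopic P P (\<psi> \<circ> \<phi>) id"
    by (rule HPol_space_homotopy_equivalence [OF P])
  have "homotopic ?Y Q (\<phi> \<circ> h) (\<phi> \<circ> k)"
    using homotopic_hausdorff_proj_cancel [OF Q continuous_map_compose [OF h \<phi>]
        continuous_map_compose [OF k \<phi>]] homotopic_postcomp [OF hk \<phi>]
    by (simp add: comp_assoc)
  from homotopic_postcomp [OF this \<psi>] have "homotopic ?Y P (\<psi> \<circ> \<phi> \<circ> h) (\<psi> \<circ> \<phi> \<circ> k)"
    by (simp add: comp_assoc)
  moreover have "homotopic ?Y P (\<psi> \<circ> \<phi> \<circ> h) h" "homotopic ?Y P (\<psi> \<circ> \<phi> \<circ> k) k"
    using homotopic_precomp [OF hom h] homotopic_precomp [OF hom k] by simp_all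
  ultimately show ?thesis
    by (meson homotopic_with_symD homotopic_with_trans)
qed

section \<open>Homotopy classes and precomposition\<close>

lemma equiv_homotopy_rel: "equiv {f. continuous_map X Y f} (homotopy_rel X Y)"
  unfolding homotopy_rel_def
  by (intro equivI refl_onI symI transI subsetI)
    (auto dest: homotopic_with_imp_continuous_maps homotopic_with_symD intro: homotopic_with_trans)

text \<open>
  The union in \<^const>\<open>homotopy_precomp\<close> is a single class, since all members of the given class have
  homotopic composites with \<open>m\<close>.
\<close>

lemma homotopy_precomp_class:
  assumes m: "continuous_map X Y m" and h: "continuous_map Y P h"
  shows "homotopy_precomp X P m (homotopy_rel Y P `` {h}) = homotopy_rel X P `` {h \<circ> m}"
proof -
  have "homotopy_rel X P `` {k \<circ> m} = homotopy_rel X P `` {h \<circ> m}"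
    if "k \<in> homotopy_rel Y P `` {h}" for k
    using that equiv_class_eq [OF equiv_homotopy_rel] homotopic_precomp [OF _ m]
    by (fastforce simp: homotopy_rel_def)
  moreover have "h \<in> homotopy_rel Y P `` {h}"
    using h by (simp add: homotopy_rel_def)
  ultimately show ?thesis
    unfolding homotopy_precomp_def by blast
qed

lemma bij_betw_homotopy_precompI:
  assumes m: "continuous_map X Y m"
    and surj: "\<And>u. continuous_map X P u \<Longrightarrow> \<exists>h. continuous_map Y P h \<and> homotopic X P (h \<circ> m) u"
    and inj: "\<And>h k. continuous_map Y P h \<Longrightarrow> continuous_map Y P k \<Longrightarrow>
      homotopic X P (h \<circ> m) (k \<circ> m) \<Longrightarrow> homotopic Y P h k"
  shows "bij_betw (homotopy_precomp X P m) (homotopy_classes Y P) (homotopy_classes X P)"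
proof -
  have class_eq: "homotopy_rel A P `` {f} = homotopy_rel A P `` {g} \<longleftrightarrow> homotopic A P f g"
    if "continuous_map A P f" "continuous_map A P g" for A :: "'x topology" and f g
    using eq_equiv_class_iff [OF equiv_homotopy_rel, of f A P g] that by (simp add: homotopy_rel_def)
  have hm: "continuous_map X P (h \<circ> m)" if "continuous_map Y P h" for h
    by (rule continuous_map_compose [OF m that])
  show ?thesis
    unfolding bij_betw_def
  proof (intro conjI subset_antisym subsetI)
    show "inj_on (homotopy_precomp X P m) (homotopy_classes Y P)"
    proof (rule inj_onI)
      fix c d assume "c \<in> homotopy_classes Y P" "d \<in> homotopy_classes Y P"
        and eq: "homotopy_precomp X P m c = homotopy_precomp X P m d"
      then obtain h k where h: "continuous_map Y P h" "c = homotopy_rel Y P `` {h}"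
          and k: "continuous_map Y P k" "d = homotopy_rel Y P `` {k}"
        by (auto simp: homotopy_classes_def elim!: quotientE)
      have "homotopic X P (h \<circ> m) (k \<circ> m)"
        using eq h k by (simp add: homotopy_precomp_class [OF m] class_eq hm)
      then show "c = d"
        using h k inj by (simp add: class_eq)
    qed
  next
    fix c assume "c \<in> homotopy_precomp X P m ` homotopy_classes Y P"
    then show "c \<in> homotopy_classes X P"
      by (auto simp: homotopy_classes_def homotopy_precomp_class [OF m] hm
          elim!: quotientE intro!: quotientI)
  next
    fix c assume "c \<in> homotopy_classes X P"
    then obtain u where u: "continuous_map X P u" "c = homotopy_rel X P `` {u}"
      by (auto simp: homotopy_classes_def elim!: quotientE)
    obtain h where h: "continuous_map Y P h" "homotopic X P (h \<circ> m) u"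
      using surj [OF u(1)] by blast
    have "c = homotopy_precomp X P m (homotopy_rel Y P `` {h})"
      using h u class_eq [OF u(1) hm] by (simp add: homotopy_precomp_class [OF m] homotopic_with_sym)
    then show "c \<in> homotopy_precomp X P m ` homotopy_classes Y P"
      using h(1) by (auto simp: homotopy_classes_def intro!: quotientI)
  qed
qed

section \<open>Composition and equality of morphisms of inverse systems\<close>

lemma pro_HPol_objectD:
  assumes "pro_HPol_object S"
  shows pro_HPol_object_le_refl: "i \<in> idx S \<Longrightarrow> le S i i"
    and pro_HPol_object_le_trans:
      "\<lbrakk>i \<in> idx S; j \<in> idx S; k \<in> idx S; le S i j; le S j k\<rbrakk> \<Longrightarrow> le S i k"
    and pro_HPol_object_directed:
      "\<lbrakk>i \<in> idx S; j \<in> idx S\<rbrakk> \<Longrightarrow> \<exists>k\<in>idx S. le S i k \<and> le S j k"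
    and pro_HPol_object_HPol: "i \<in> idx S \<Longrightarrow> HPol_space (term_of S i)"
    and pro_HPol_object_bond_id:
      "i \<in> idx S \<Longrightarrow> homotopic (term_of S i) (term_of S i) (bond S i i) id"
    and pro_HPol_object_continuous_bond:
      "\<lbrakk>i \<in> idx S; j \<in> idx S; le S i j\<rbrakk> \<Longrightarrow> continuous_map (term_of S j) (term_of S i) (bond S i j)"
    and pro_HPol_object_bond_comp:
      "\<lbrakk>i \<in> idx S; j \<in> idx S; k \<in> idx S; le S i j; le S j k\<rbrakk> \<Longrightarrow>
        homotopic (term_of S k) (term_of S i) (bond S i j \<circ> bond S j k) (bond S i k)"
  using assms unfolding pro_HPol_object_def directed_index_def by blast+

lemma pro_morphismD:
  assumes "pro_morphism S T f" "j \<in> idx T"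
  shows "ind f j \<in> idx S"
    and "continuous_map (term_of S (ind f j)) (term_of T j) (comp_at f j)"
  using assms unfolding pro_morphism_def by blast+

text \<open>
  Two maps out of terms of \<open>S\<close> that agree at some stage agree at all later stages. This lets finitely
  many such agreements be moved to a common stage, as composition and transitivity require.
\<close>

lemma homotopic_later_stage:
  assumes S: "pro_HPol_object S"
    and idx: "i \<in> idx S" "j \<in> idx S" "k \<in> idx S" "l \<in> idx S"
    and le: "le S i k" "le S j k" "le S k l"
    and a: "continuous_map (term_of S i) P a" and b: "continuous_map (term_of S j) P b"
    and hom: "homotopic (term_of S k) P (a \<circ> bond S i k) (b \<circ> bond S j k)"
  shows "homotopic (term_of S l) P (a \<circ> bond S i l) (b \<circ> bond S j l)"
proof -
  have "homotopic (term_of S l) P (a \<circ> bond S i l) (a \<circ> (bond S i k \<circ> bond S k l))"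
    by (intro homotopic_with_symD [OF homotopic_postcomp [OF _ a]]
        pro_HPol_object_bond_comp [OF S] idx le)
  moreover have "homotopic (term_of S l) P (a \<circ> (bond S i k \<circ> bond S k l)) (b \<circ> (bond S j k \<circ> bond S k l))"
    using homotopic_precomp [OF hom pro_HPol_object_continuous_bond [OF S idx(3,4) le(3)]]
    by (simp add: comp_assoc)
  moreover have "homotopic (term_of S l) P (b \<circ> (bond S j k \<circ> bond S k l)) (b \<circ> bond S j l)"
    by (intro homotopic_postcomp [OF _ b] pro_HPol_object_bond_comp [OF S] idx le)
  ultimately show ?thesis
    by (meson homotopic_with_trans)
qed

lemma pro_eq_sym: "pro_eq S T f g \<Longrightarrow> pro_eq S T g f"
  unfolding pro_eq_def by (meson homotopic_with_symD)

lemma pro_eq_trans: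
  assumes S: "pro_HPol_object S"
    and f: "pro_morphism S T f" and g: "pro_morphism S T g" and h: "pro_morphism S T h"
    and fg: "pro_eq S T f g" and gh: "pro_eq S T g h"
  shows "pro_eq S T f h"
  unfolding pro_eq_def
proof
  fix j assume j: "j \<in> idx T"
  note F = pro_morphismD [OF f j] and G = pro_morphismD [OF g j] and H = pro_morphismD [OF h j]
  obtain i1 where i1: "i1 \<in> idx S" "le S (ind f j) i1" "le S (ind g j) i1"
      "homotopic (term_of S i1) (term_of T j)
         (comp_at f j \<circ> bond S (ind f j) i1) (comp_at g j \<circ> bond S (ind g j) i1)"
    using fg j unfolding pro_eq_def by blast
  obtain i2 where i2: "i2 \<in> idx S" "le S (ind g j) i2" "le S (ind h j) i2"
      "homotopic (term_of S i2) (term_of T j)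
         (comp_at g j \<circ> bond S (ind g j) i2) (comp_at h j \<circ> bond S (ind h j) i2)"
    using gh j unfolding pro_eq_def by blast
  obtain i where i: "i \<in> idx S" "le S i1 i" "le S i2 i"
    using pro_HPol_object_directed [OF S i1(1) i2(1)] by blast
  have "homotopic (term_of S i) (term_of T j)
         (comp_at f j \<circ> bond S (ind f j) i) (comp_at g j \<circ> bond S (ind g j) i)"
    by (rule homotopic_later_stage [OF S F(1) G(1) i1(1) i(1) i1(2,3) i(2) F(2) G(2) i1(4)])
  moreover have "homotopic (term_of S i) (term_of T j)
         (comp_at g j \<circ> bond S (ind g j) i) (comp_at h j \<circ> bond S (ind h j) i)"
    by (rule homotopic_later_stage [OF S G(1) H(1) i2(1) i(1) i2(2,3) i(3) G(2) H(2) i2(4)])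
  ultimately have "homotopic (term_of S i) (term_of T j)
         (comp_at f j \<circ> bond S (ind f j) i) (comp_at h j \<circ> bond S (ind h j) i)"
    by (rule homotopic_with_trans)
  moreover have "le S (ind f j) i" "le S (ind h j) i"
    using pro_HPol_object_le_trans [OF S] F(1) H(1) i1 i2 i by blast+
  ultimately show "\<exists>i\<in>idx S. le S (ind f j) i \<and> le S (ind h j) i \<and>
      homotopic (term_of S i) (term_of T j)
        (comp_at f j \<circ> bond S (ind f j) i) (comp_at h j \<circ> bond S (ind h j) i)"
    using i(1) by blast
qed

lemma pro_morphism_id:
  assumes S: "pro_HPol_object S"
  shows "pro_morphism S S pro_id"
  unfolding pro_morphism_def
proof (intro conjI ballI impI)
  fix j k assume jk: "j \<in> idx S" "k \<in> idx S" "le S j k"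
  have "homotopic (term_of S k) (term_of S j) (bond S j k \<circ> bond S k k) (bond S j k)"
    by (intro pro_HPol_object_bond_comp [OF S] jk pro_HPol_object_le_refl [OF S])
  then have "homotopic (term_of S k) (term_of S j) (bond S j k) (bond S j k \<circ> bond S k k)"
    by (rule homotopic_with_symD)
  then show "\<exists>i\<in>idx S. le S (ind pro_id j) i \<and> le S (ind pro_id k) i \<and>
      homotopic (term_of S i) (term_of S j) (comp_at pro_id j \<circ> bond S (ind pro_id j) i)
        (bond S j k \<circ> comp_at pro_id k \<circ> bond S (ind pro_id k) i)"
    using jk pro_HPol_object_le_refl [OF S]
    by (intro bexI [of _ k]) (simp_all add: pro_id_def)
qed (simp_all add: pro_id_def)

text \<open>
  The compatibility of \<open>g\<close> for \<open>j \<le> k\<close> holds at a stage \<open>t\<close> of \<open>T\<close>. Replacing the bonding maps of \<open>T\<close>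
  into \<open>t\<close> by the component of \<open>f\<close> at \<open>t\<close> costs one compatibility of \<open>f\<close> for each of \<open>j\<close> and \<open>k\<close>.
\<close>

lemma pro_morphism_comp:
  assumes S: "pro_HPol_object S" and T: "pro_HPol_object T" and U: "pro_HPol_object U"
    and f: "pro_morphism S T f" and g: "pro_morphism T U g"
  shows "pro_morphism S U (pro_comp g f)"
  unfolding pro_morphism_def
proof (intro conjI ballI impI)
  fix j assume j: "j \<in> idx U"
  show "ind (pro_comp g f) j \<in> idx S"
    using pro_morphismD [OF f] pro_morphismD [OF g] j by (simp add: pro_comp_def)
  show "continuous_map (term_of S (ind (pro_comp g f) j)) (term_of U j) (comp_at (pro_comp g f) j)"
    using continuous_map_compose [OF pro_morphismD(2) [OF f] pro_morphismD(2) [OF g j]]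
      pro_morphismD(1) [OF g j] by (simp add: pro_comp_def)
next
  fix j k assume jk: "j \<in> idx U" "k \<in> idx U" "le U j k"
  obtain t where t: "t \<in> idx T" "le T (ind g j) t" "le T (ind g k) t"
      and ht: "homotopic (term_of T t) (term_of U j) (comp_at g j \<circ> bond T (ind g j) t)
         (bond U j k \<circ> comp_at g k \<circ> bond T (ind g k) t)"
    using g jk unfolding pro_morphism_def by blast
  have gi: "ind g j \<in> idx T" "ind g k \<in> idx T"
    using pro_morphismD [OF g] jk by blast+
  note fi = pro_morphismD(1) [OF f gi(1)] pro_morphismD(1) [OF f gi(2)] pro_morphismD(1) [OF f t(1)]
  note fc = pro_morphismD(2) [OF f gi(1)] pro_morphismD(2) [OF f gi(2)] pro_morphismD(2) [OF f t(1)]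
  note gc = pro_morphismD(2) [OF g jk(1)]
    continuous_map_compose [OF pro_morphismD(2) [OF g jk(2)] pro_HPol_object_continuous_bond [OF U jk]]
  have swap: "\<exists>i\<in>idx S. le S (ind f s) i \<and> le S (ind f t) i \<and>
        homotopic (term_of S i) (term_of T s) (comp_at f s \<circ> bond S (ind f s) i)
          ((bond T s t \<circ> comp_at f t) \<circ> bond S (ind f t) i)"
    if "s \<in> idx T" "le T s t" for s
    using f that t(1) unfolding pro_morphism_def by blast
  obtain i1 where i1: "i1 \<in> idx S" "le S (ind f (ind g j)) i1" "le S (ind f t) i1"
      "homotopic (term_of S i1) (term_of T (ind g j))
          (comp_at f (ind g j) \<circ> bond S (ind f (ind g j)) i1)
          ((bond T (ind g j) t \<circ> comp_at f t) \<circ> bond S (ind f t) i1)"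
    using swap [OF gi(1) t(2)] by blast
  obtain i2 where i2: "i2 \<in> idx S" "le S (ind f (ind g k)) i2" "le S (ind f t) i2"
      "homotopic (term_of S i2) (term_of T (ind g k))
          (comp_at f (ind g k) \<circ> bond S (ind f (ind g k)) i2)
          ((bond T (ind g k) t \<circ> comp_at f t) \<circ> bond S (ind f t) i2)"
    using swap [OF gi(2) t(3)] by blast
  obtain i where i: "i \<in> idx S" "le S i1 i" "le S i2 i"
    using pro_HPol_object_directed [OF S i1(1) i2(1)] by blast
  have les: "le S (ind f (ind g j)) i" "le S (ind f (ind g k)) i" "le S (ind f t) i"
    using pro_HPol_object_le_trans [OF S] fi i1 i2 i by blast+
  have "homotopic (term_of S i) (term_of T (ind g j))
          (comp_at f (ind g j) \<circ> bond S (ind f (ind g j)) i)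
          ((bond T (ind g j) t \<circ> comp_at f t) \<circ> bond S (ind f t) i)"
    by (rule homotopic_later_stage [OF S fi(1,3) i1(1) i(1) i1(2,3) i(2) fc(1)
        continuous_map_compose [OF fc(3) pro_HPol_object_continuous_bond [OF T gi(1) t(1,2)]] i1(4)])
  from homotopic_postcomp [OF this gc(1)]
  have 1: "homotopic (term_of S i) (term_of U j)
      (comp_at g j \<circ> comp_at f (ind g j) \<circ> bond S (ind f (ind g j)) i)
      (comp_at g j \<circ> bond T (ind g j) t \<circ> comp_at f t \<circ> bond S (ind f t) i)"
    by (simp add: comp_assoc)
  have "homotopic (term_of S i) (term_of T (ind g k))
          (comp_at f (ind g k) \<circ> bond S (ind f (ind g k)) i)
          ((bond T (ind g k) t \<circ> comp_at f t) \<circ> bond S (ind f t) i)"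
    by (rule homotopic_later_stage [OF S fi(2,3) i2(1) i(1) i2(2,3) i(3) fc(2)
        continuous_map_compose [OF fc(3) pro_HPol_object_continuous_bond [OF T gi(2) t(1,3)]] i2(4)])
  from homotopic_postcomp [OF this gc(2)]
  have 2: "homotopic (term_of S i) (term_of U j)
      (bond U j k \<circ> (comp_at g k \<circ> comp_at f (ind g k)) \<circ> bond S (ind f (ind g k)) i)
      (bond U j k \<circ> comp_at g k \<circ> bond T (ind g k) t \<circ> comp_at f t \<circ> bond S (ind f t) i)"
    by (simp add: comp_assoc)
  have 3: "homotopic (term_of S i) (term_of U j)
      (comp_at g j \<circ> bond T (ind g j) t \<circ> comp_at f t \<circ> bond S (ind f t) i)
      (bond U j k \<circ> comp_at g k \<circ> bond T (ind g k) t \<circ> comp_at f t \<circ> bond S (ind f t) i)"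
    using homotopic_precomp [OF ht continuous_map_compose [OF
          pro_HPol_object_continuous_bond [OF S fi(3) i(1) les(3)] fc(3)]]
    by (simp add: comp_assoc)
  have "homotopic (term_of S i) (term_of U j)
      (comp_at g j \<circ> comp_at f (ind g j) \<circ> bond S (ind f (ind g j)) i)
      (bond U j k \<circ> (comp_at g k \<circ> comp_at f (ind g k)) \<circ> bond S (ind f (ind g k)) i)"
    using 1 2 3 by (meson homotopic_with_symD homotopic_with_trans)
  then show "\<exists>i\<in>idx S. le S (ind (pro_comp g f) j) i \<and> le S (ind (pro_comp g f) k) i \<and>
      homotopic (term_of S i) (term_of U j)
        (comp_at (pro_comp g f) j \<circ> bond S (ind (pro_comp g f) j) i)
        (bond U j k \<circ> comp_at (pro_comp g f) k \<circ> bond S (ind (pro_comp g f) k) i)"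
    using i(1) les by (intro bexI [of _ i]) (simp_all add: pro_comp_def)
qed

section \<open>Expansions and induced morphisms\<close>

lemma coneD:
  assumes "cone X S p"
  shows cone_continuous: "i \<in> idx S \<Longrightarrow> continuous_map X (term_of S i) (p i)"
    and cone_bond: "\<lbrakk>i \<in> idx S; j \<in> idx S; le S i j\<rbrakk> \<Longrightarrow>
      homotopic X (term_of S i) (p i) (bond S i j \<circ> p j)"
  using assms unfolding cone_def by blast+

lemma cone_precomp:
  assumes q: "cone Y T q" and m: "continuous_map X Y m"
  shows "cone X T (\<lambda>j. q j \<circ> m)"
  using continuous_map_compose [OF m cone_continuous [OF q]] homotopic_precomp [OF cone_bond [OF q] m]
  unfolding cone_def by (simp add: comp_assoc)

lemma cone_comp_pro_comp:
  assumes g: "pro_morphism S T g" and pq: "cone_eq X S (cone_comp f p) q"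
  shows "cone_eq X T (cone_comp (pro_comp g f) p) (cone_comp g q)"
  unfolding cone_eq_def
proof
  fix j assume j: "j \<in> idx T"
  note G = pro_morphismD [OF g j]
  have "homotopic X (term_of S (ind g j)) (cone_comp f p (ind g j)) (q (ind g j))"
    using pq G(1) unfolding cone_eq_def by blast
  from homotopic_postcomp [OF this G(2)]
  show "homotopic X (term_of T j) (cone_comp (pro_comp g f) p j) (cone_comp g q j)"
    by (simp add: cone_comp_def pro_comp_def comp_assoc)
qed

lemma cone_comp_id: "cone X S p \<Longrightarrow> cone_eq X S (cone_comp pro_id p) p"
  by (simp add: cone_eq_def cone_comp_def pro_id_def cone_continuous)

lemma cone_eq_trans: "cone_eq X S p q \<Longrightarrow> cone_eq X S q r \<Longrightarrow> cone_eq X S p r"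
  unfolding cone_eq_def by (meson homotopic_with_trans)

lemma cone_eq_precomp:
  "cone_eq Y S p q \<Longrightarrow> continuous_map X Y m \<Longrightarrow> cone_eq X S (\<lambda>i. p i \<circ> m) (\<lambda>i. q i \<circ> m)"
  unfolding cone_eq_def by (blast intro: homotopic_precomp)

lemma HPol_expansionD:
  assumes "HPol_expansion X S p"
  shows "pro_HPol_object S" and "cone X S p"
  using assms unfolding HPol_expansion_def by simp_all

lemma HPol_expansion_universal:
  fixes S T :: "('i, 'p) inv_system"
  assumes S: "HPol_expansion X S p" and T: "pro_HPol_object T" and h: "cone X T h"
  obtains f where "pro_morphism S T f" "cone_eq X T (cone_comp f p) h"
    "\<And>g. \<lbrakk>pro_morphism S T g; cone_eq X T (cone_comp g p) h\<rbrakk> \<Longrightarrow> pro_eq S T f g"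
proof -
  have "\<exists>f. pro_morphism S T f \<and> cone_eq X T (cone_comp f p) h \<and>
      (\<forall>g. pro_morphism S T g \<and> cone_eq X T (cone_comp g p) h \<longrightarrow> pro_eq S T f g)"
    using S T h unfolding HPol_expansion_def by simp
  then show thesis
    using that by (elim exE conjE) simp
qed

text \<open>
  The identity factors the cone \<open>p\<close> through itself, so uniqueness of factorizations leaves no other
  class of endomorphisms fixing \<open>p\<close>. Applied to \<open>g \<circ> f\<close> and \<open>f \<circ> g\<close>, this is how two morphisms are
  recognized as mutually inverse.
\<close>

lemma HPol_expansion_endo_eq_id:
  assumes S: "HPol_expansion X S p" and f: "pro_morphism S S f"
    and fp: "cone_eq X S (cone_comp f p) p"
  shows "pro_eq S S f pro_id"
proof -
  note obj = HPol_expansionD(1) [OF S] and p = HPol_expansionD(2) [OF S]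
  obtain e where e: "pro_morphism S S e"
      "\<And>g. \<lbrakk>pro_morphism S S g; cone_eq X S (cone_comp g p) p\<rbrakk> \<Longrightarrow> pro_eq S S e g"
    by (rule HPol_expansion_universal [OF S obj p]) (rule that)
  have "pro_eq S S f e"
    by (rule pro_eq_sym [OF e(2) [OF f fp]])
  moreover have "pro_eq S S e pro_id"
    by (intro e(2) pro_morphism_id obj cone_comp_id p)
  ultimately show ?thesis
    using pro_eq_trans [OF obj f e(1) pro_morphism_id [OF obj]] by blast
qed

text \<open>
  The assumptions \<open>surj\<close> and \<open>inj\<close> say that \<open>m\<close> induces bijections on homotopy classes of maps into
  objects of \<open>HPol\<close>. Surjectivity produces the cone \<open>p'\<close> over \<open>Y\<close> one term at a time; injectivity makes
  the chosen maps compatible with the bonding maps, and later transports \<open>f \<circ> g \<circ> q \<simeq> q\<close> from \<open>X\<close>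
  to \<open>Y\<close>.
\<close>

theorem shape_equivalence_if_bij_on_HPol:
  fixes X :: "'a topology" and Y :: "'b topology"
  assumes m: "continuous_map X Y m"
    and surj: "\<And>(P :: 'p topology) u. HPol_space P \<Longrightarrow> continuous_map X P u \<Longrightarrow>
      \<exists>h. continuous_map Y P h \<and> homotopic X P (h \<circ> m) u"
    and inj: "\<And>(P :: 'p topology) h k. HPol_space P \<Longrightarrow> continuous_map Y P h \<Longrightarrow>
      continuous_map Y P k \<Longrightarrow> homotopic X P (h \<circ> m) (k \<circ> m) \<Longrightarrow> homotopic Y P h k"
  shows "shape_equivalence TYPE('i) TYPE('p) X Y m"
  unfolding shape_equivalence_def
proof (intro conjI allI impI m, elim conjE)
  fix S T :: "('i, 'p) inv_system" and p q
  assume expS: "HPol_expansion X S p" and expT: "HPol_expansion Y T q"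
  note S = HPol_expansionD(1) [OF expS] and p = HPol_expansionD(2) [OF expS]
  note T = HPol_expansionD(1) [OF expT] and q = HPol_expansionD(2) [OF expT]
  obtain f where f: "pro_morphism S T f" "cone_eq X T (cone_comp f p) (\<lambda>j. q j \<circ> m)"
    by (rule HPol_expansion_universal [OF expS T cone_precomp [OF q m]]) (rule that)
  have "\<forall>i\<in>idx S. \<exists>h. continuous_map Y (term_of S i) h \<and> homotopic X (term_of S i) (h \<circ> m) (p i)"
    using surj pro_HPol_object_HPol [OF S] cone_continuous [OF p] by blast
  then obtain p' where p': "\<And>i. i \<in> idx S \<Longrightarrow> continuous_map Y (term_of S i) (p' i)"
      "\<And>i. i \<in> idx S \<Longrightarrow> homotopic X (term_of S i) (p' i \<circ> m) (p i)"
    by metis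
  have p'm: "cone_eq X S (\<lambda>i. p' i \<circ> m) p"
    using p'(2) by (simp add: cone_eq_def)
  have "cone Y S p'"
    unfolding cone_def
  proof (intro conjI ballI impI p'(1))
    fix i j assume ij: "i \<in> idx S" "j \<in> idx S" "le S i j"
    note B = pro_HPol_object_continuous_bond [OF S ij]
    have "homotopic X (term_of S i) (p' i \<circ> m) (p i)"
      by (rule p'(2) [OF ij(1)])
    moreover have "homotopic X (term_of S i) (p i) (bond S i j \<circ> p j)"
      by (rule cone_bond [OF p ij])
    moreover have "homotopic X (term_of S i) (bond S i j \<circ> p j) ((bond S i j \<circ> p' j) \<circ> m)"
      using homotopic_with_symD [OF homotopic_postcomp [OF p'(2) [OF ij(2)] B]]
      by (simp add: comp_assoc)
    ultimately have "homotopic X (term_of S i) (p' i \<circ> m) ((bond S i j \<circ> p' j) \<circ> m)"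
      by (meson homotopic_with_trans)
    then show "homotopic Y (term_of S i) (p' i) (bond S i j \<circ> p' j)"
      by (intro inj pro_HPol_object_HPol [OF S] p'(1) continuous_map_compose [OF p'(1) B] ij)
  qed
  then obtain g where g: "pro_morphism T S g" "cone_eq Y S (cone_comp g q) p'"
    by (rule HPol_expansion_universal [OF expT S]) (rule that)
  note gf = pro_morphism_comp [OF S T S f(1) g(1)] and fg = pro_morphism_comp [OF T S T g(1) f(1)]
  have gqm: "cone_eq X S (cone_comp g (\<lambda>j. q j \<circ> m)) (\<lambda>i. p' i \<circ> m)"
    using cone_eq_precomp [OF g(2) m] by (simp add: cone_comp_def comp_assoc)
  have "cone_eq X S (cone_comp (pro_comp g f) p) p"
    using cone_comp_pro_comp [OF g(1) f(2)] gqm p'm by (meson cone_eq_trans)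
  then have 1: "pro_eq S S (pro_comp g f) pro_id"
    by (rule HPol_expansion_endo_eq_id [OF expS gf])
  \<comment> \<open>Both sides of \<open>f \<circ> g \<circ> q \<simeq> q\<close> are maps on \<open>Y\<close>, so the comparison may be made after
    precomposing with \<open>m\<close>, where \<open>g \<circ> q \<circ> m \<simeq> p\<close> and \<open>f \<circ> p \<simeq> q \<circ> m\<close>.\<close>
  have "cone_eq X S (cone_comp g (\<lambda>j. q j \<circ> m)) p"
    using gqm p'm by (rule cone_eq_trans)
  from cone_eq_trans [OF cone_comp_pro_comp [OF f(1) this] f(2)]
  have fgm: "cone_eq X T (\<lambda>j. cone_comp (pro_comp f g) q j \<circ> m) (\<lambda>j. q j \<circ> m)"
    by (simp add: cone_comp_def comp_assoc)
  have "cone_eq Y T (cone_comp (pro_comp f g) q) q"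
    unfolding cone_eq_def
  proof
    fix j assume j: "j \<in> idx T"
    note F = pro_morphismD [OF fg j]
    have "continuous_map Y (term_of T j) (cone_comp (pro_comp f g) q j)"
      unfolding cone_comp_def by (rule continuous_map_compose [OF cone_continuous [OF q F(1)] F(2)])
    then show "homotopic Y (term_of T j) (cone_comp (pro_comp f g) q j) (q j)"
      using fgm j unfolding cone_eq_def
      by (intro inj pro_HPol_object_HPol [OF T] cone_continuous [OF q]) auto
  qed
  then have 2: "pro_eq T T (pro_comp f g) pro_id"
    by (rule HPol_expansion_endo_eq_id [OF expT fg])
  show "\<exists>f. induces_pro_morphism X p S q T m f \<and> pro_iso S T f"
    using f g(1) 1 2 unfolding induces_pro_morphism_def pro_iso_def by blast
qed

section \<open>The Hausdorff reflection is a shape equivalence\<close>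

lemma metric_ANR_imp_HPol_space: "metric_ANR P \<Longrightarrow> HPol_space P"
  unfolding HPol_space_def using homotopy_equivalent_space_refl by blast

theorem theorem11:
  fixes X :: "'a topology"
  shows "shape_equivalence TYPE('i) TYPE('p) X (hausdorff_reflection X) (hausdorff_proj X) \<and>
    (\<forall>P :: 'p topology. metric_ANR P \<longrightarrow>
       bij_betw (homotopy_precomp X P (hausdorff_proj X))
         (homotopy_classes (hausdorff_reflection X) P) (homotopy_classes X P))"
proof (intro conjI allI impI)
  show "shape_equivalence TYPE('i) TYPE('p) X (hausdorff_reflection X) (hausdorff_proj X)"
    by (rule shape_equivalence_if_bij_on_HPol [OF continuous_map_hausdorff_proj
        HPol_factors_through_hausdorff_proj HPol_homotopic_hausdorff_proj_cancel])
next
  fix P :: "'p topology" assume "metric_ANR P"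
  then have P: "HPol_space P"
    by (rule metric_ANR_imp_HPol_space)
  show "bij_betw (homotopy_precomp X P (hausdorff_proj X))
         (homotopy_classes (hausdorff_reflection X) P) (homotopy_classes X P)"
    by (rule bij_betw_homotopy_precompI [OF continuous_map_hausdorff_proj
        HPol_factors_through_hausdorff_proj [OF P] HPol_homotopic_hausdorff_proj_cancel [OF P]])
qed

end
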